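(* Let $n\ge2$. Suppose $\Omega_1,\ldots,\Omega_n$ are subsets of a normed vector space $X$, $\bigcap_{i=1}^n\Omega_i=\emptyset$, $\omega_i\in\Omega_i$ $(i=1,\ldots,n)$, and $\varepsilon>0$. If $$d_1(\omega_1,\ldots,\omega_n)<d_1(\Omega_1,\ldots,\Omega_n)+\varepsilon,$$ then $M:=d_1(\omega_1,\ldots,\omega_n)>0$ and $$\bigcap_{i=1}^{n-1}(\Omega_i-\omega_i-a_i)\cap(\Omega_n-\omega_n)=\emptyset\quad\text{and}\quad\max_{1\le i\le n-1}\|a_i\|<\varepsilon,$$ where $a_i:=\frac{\varepsilon'}{M}(\omega_n-\omega_i)$ $(i=1,\ldots,n-1)$ and $\varepsilon'$ is either any number in $[0,\varepsilon)$ satisfying $M-d_1(\Omega_1,\ldots,\Omega_n)<\varepsilon'\le M$ if $d_1(\Omega_1,\ldots,\Omega_n)>0$, or $\varepsilon'=M$ if $d_1(\Omega_1,\ldots,\Omega_n)=0$.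
   Context: For points, $d_1(\omega_1,\ldots,\omega_n):=\max_{1\le i\le n-1}\|\omega_i-\omega_n\|$; for sets, $d_1(\Omega_1,\ldots,\Omega_n):=\inf_{\omega_1\in\Omega_1,\ldots,\omega_n\in\Omega_n}d_1(\omega_1,\ldots,\omega_n)$. *)

theory Defs
  imports Complex_Main "HOL-Library.FuncSet"
begin

text \<open>An n-tuple is a function on \<^typ>\<open>nat\<close> of which only the values at \<open>1, \<dots>, n\<close> matter.
  Both quantities are meant for \<open>n \<ge> 2\<close>, so that the index range \<open>{1..n-1}\<close> is nonempty.\<close>

definition d1 :: "nat \<Rightarrow> (nat \<Rightarrow> 'a::real_normed_vector) \<Rightarrow> real" where
  "d1 n \<omega> = Max ((\<lambda>i. norm (\<omega> i - \<omega> n)) ` {1..n-1})"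

text \<open>The infimum is taken in the reals. If all the sets are nonempty, this is the infimum of a
  nonempty set of nonnegative numbers; if one is empty, the value is unspecified.\<close>

definition d1_sets :: "nat \<Rightarrow> (nat \<Rightarrow> 'a::real_normed_vector set) \<Rightarrow> real" where
  "d1_sets n \<Omega> = (INF \<omega> \<in> Pi {1..n} \<Omega>. d1 n \<omega>)"

end

theory Submission
  imports Defs
begin

text \<open>A common point of the shifted sets would give points of the \<open>\<Omega> i\<close> forming a copy of the
  configuration \<open>\<omega>\<close> scaled by \<open>1 - \<epsilon>' / M\<close>, so their \<open>d1\<close> would be at most \<open>M - \<epsilon>'\<close>. This is
  below the infimum if the infimum is positive, and it is \<open>0\<close> if \<open>\<epsilon>' = M\<close>, in which case these
  points coincide and lie in the empty intersection.\<close>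

lemma norm_diff_le_d1:
  assumes "i \<in> {1..n-1}"
  shows "norm (\<omega> i - \<omega> n) \<le> d1 n \<omega>"
  unfolding d1_def using assms by (intro Max_ge) auto

text \<open>The condition \<open>n \<ge> 2\<close> makes \<open>{1..n-1}\<close> nonempty; over an
  empty index range \<open>Max\<close> would be unspecified and the right-hand side vacuously
  true.\<close>

lemma d1_le_iff:
  assumes "n \<ge> 2"
  shows "d1 n \<omega> \<le> c \<longleftrightarrow> (\<forall>i\<in>{1..n-1}. norm (\<omega> i - \<omega> n) \<le> c)"
  unfolding d1_def using assms by (subst Max_le_iff) auto

lemma d1_nonneg:
  assumes "n \<ge> 2"
  shows "0 \<le> d1 n \<omega>"
  using order_trans[OF norm_ge_zero norm_diff_le_d1[of 1 n \<omega>]] assms by simp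

lemma d1_sets_le:
  assumes "n \<ge> 2" and "\<omega> \<in> Pi {1..n} \<Omega>"
  shows "d1_sets n \<Omega> \<le> d1 n \<omega>"
  unfolding d1_sets_def
proof (rule cINF_lower)
  show "bdd_below (d1 n ` Pi {1..n} \<Omega>)"
    using d1_nonneg[OF assms(1)] by (auto intro!: bdd_belowI[where m = 0])
qed (fact assms(2))

text \<open>Otherwise all points coincide with \<open>\<omega> n\<close>, which then lies in every
  set. This serves twice: for the given points it yields \<open>M > 0\<close>, and for the points
  built from a supposed common element it settles the case \<open>d = 0\<close>.\<close>

lemma d1_pos_of_Inter_empty:
  fixes \<omega> :: "nat \<Rightarrow> 'a::real_normed_vector"
  assumes "n \<ge> 2" and "(\<Inter>i\<in>{1..n}. \<Omega> i) = {}" and "\<omega> \<in> Pi {1..n} \<Omega>"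
  shows "0 < d1 n \<omega>"
proof (rule ccontr)
  assume "\<not> 0 < d1 n \<omega>"
  then have "\<forall>i\<in>{1..n-1}. norm (\<omega> i - \<omega> n) \<le> 0"
    using d1_le_iff[OF assms(1), of \<omega> 0] by simp
  then have "\<omega> i = \<omega> n" if "i \<in> {1..n}" for i
    using that by (cases "i = n") auto
  then have "\<omega> n \<in> (\<Inter>i\<in>{1..n}. \<Omega> i)"
    using assms(3) by (metis INT_I PiE)
  with assms(2) show False by simp
qed

theorem proposition4p3:
  fixes n :: nat
    and \<Omega> :: "nat \<Rightarrow> 'a::real_normed_vector set"
    and \<omega> :: "nat \<Rightarrow> 'a"
    and \<epsilon> :: real
  assumes "n \<ge> 2"
    and "(\<Inter>i\<in>{1..n}. \<Omega> i) = {}"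
    and "\<And>i. i \<in> {1..n} \<Longrightarrow> \<omega> i \<in> \<Omega> i"
    and "\<epsilon> > 0"
    and "d1 n \<omega> < d1_sets n \<Omega> + \<epsilon>"
  shows "let M = d1 n \<omega>; d = d1_sets n \<Omega> in
    M > 0 \<and>
    (\<forall>\<epsilon>'::real.
      (d > 0 \<and> \<epsilon>' \<in> {0..<\<epsilon>} \<and> M - d < \<epsilon>' \<and> \<epsilon>' \<le> M) \<or> (d = 0 \<and> \<epsilon>' = M) \<longrightarrow>
      (let a = (\<lambda>i. (\<epsilon>' / M) *\<^sub>R (\<omega> n - \<omega> i)) in
        (\<Inter>i\<in>{1..n-1}. (\<lambda>x. x - \<omega> i - a i) ` \<Omega> i) \<inter> (\<lambda>x. x - \<omega> n) ` \<Omega> n = {} \<and>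
        Max ((\<lambda>i. norm (a i)) ` {1..n-1}) < \<epsilon>))"
proof -
  define M where "M = d1 n \<omega>"
  define d where "d = d1_sets n \<Omega>"
  have \<omega>: "\<omega> \<in> Pi {1..n} \<Omega>" using assms(3) by blast
  have M_pos: "M > 0"
    unfolding M_def using d1_pos_of_Inter_empty[OF assms(1,2) \<omega>] .
  have main: "(\<Inter>i\<in>{1..n-1}. (\<lambda>x. x - \<omega> i - a i) ` \<Omega> i) \<inter> (\<lambda>x. x - \<omega> n) ` \<Omega> n = {} \<and>
      Max ((\<lambda>i. norm (a i)) ` {1..n-1}) < \<epsilon>"
    if \<epsilon>': "(d > 0 \<and> \<epsilon>' \<in> {0..<\<epsilon>} \<and> M - d < \<epsilon>' \<and> \<epsilon>' \<le> M) \<or> (d = 0 \<and> \<epsilon>' = M)"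
      and a: "a = (\<lambda>i. (\<epsilon>' / M) *\<^sub>R (\<omega> n - \<omega> i))"
    for \<epsilon>' :: real and a
  proof
    \<comment> \<open>Only the case \<open>d = 0\<close> needs an argument: there
      \<open>\<epsilon>' = M\<close>, and the near-minimality assumption reduces to
      \<open>M < \<epsilon>\<close>.\<close>
    have bounds: "0 \<le> \<epsilon>'" "\<epsilon>' < \<epsilon>" "\<epsilon>' \<le> M"
      using \<epsilon>' M_pos assms(5) by (auto simp: M_def d_def)
    \<comment> \<open>Since \<open>M\<close> is the largest of the distances to
      \<open>\<omega> n\<close>, the factor \<open>\<epsilon>' / M\<close> shrinks each of them to
      at most \<open>\<epsilon>'\<close>.\<close>
    have "norm (a i) \<le> \<epsilon>'" if "i \<in> {1..n-1}" for i
    proof -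
      have "norm (a i) = \<epsilon>' / M * norm (\<omega> i - \<omega> n)"
        using bounds M_pos by (simp add: a norm_minus_commute)
      also have "\<dots> \<le> \<epsilon>' / M * M"
        using norm_diff_le_d1[OF that, of \<omega>] bounds M_pos
        by (intro mult_left_mono) (auto simp: M_def)
      finally show ?thesis using M_pos by simp
    qed
    then have "norm (a i) < \<epsilon>" if "i \<in> {1..n-1}" for i
      using that bounds by fastforce
    then show "Max ((\<lambda>i. norm (a i)) ` {1..n-1}) < \<epsilon>"
      using assms(1) by (subst Max_less_iff) auto
    show "(\<Inter>i\<in>{1..n-1}. (\<lambda>x. x - \<omega> i - a i) ` \<Omega> i) \<inter> (\<lambda>x. x - \<omega> n) ` \<Omega> n = {}"
    proof (rule ccontr)
      assume "\<not> ?thesis"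
      then obtain x where
        x: "\<And>i. i \<in> {1..n-1} \<Longrightarrow> x \<in> (\<lambda>x. x - \<omega> i - a i) ` \<Omega> i"
        and xn: "x \<in> (\<lambda>x. x - \<omega> n) ` \<Omega> n"
        by blast
      \<comment> \<open>Undoing the shifts on \<open>x\<close> recovers points of the sets. The
        formula also covers \<open>i = n\<close>, because \<open>a n = 0\<close>.\<close>
      define y where "y i = x + \<omega> i + a i" for i
      have "y i \<in> \<Omega> i" if "i \<in> {1..n}" for i
      proof (cases "i = n")
        case True
        then show ?thesis using xn by (auto simp: y_def a)
      next
        case False
        then have "i \<in> {1..n-1}" using that by auto
        then show ?thesis using x[of i] by (auto simp: y_def)
      qed
      then have y: "y \<in> Pi {1..n} \<Omega>" by blast
      have "norm (y i - y n) \<le> M - \<epsilon>'" if "i \<in> {1..n-1}" for i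
      proof -
        \<comment> \<open>The common translation \<open>x\<close> cancels, and \<open>a i\<close>
          moves \<open>\<omega> i\<close> towards \<open>\<omega> n\<close> by the fraction
          \<open>\<epsilon>' / M\<close> of their difference. The remaining factor is nonnegative
          because \<open>\<epsilon>' \<le> M\<close>.\<close>
        have "y i - y n = (1 - \<epsilon>' / M) *\<^sub>R (\<omega> i - \<omega> n)"
          by (simp add: y_def a algebra_simps)
        then have "norm (y i - y n) = (1 - \<epsilon>' / M) * norm (\<omega> i - \<omega> n)"
          using bounds M_pos by simp
        also have "\<dots> \<le> (1 - \<epsilon>' / M) * M"
          using norm_diff_le_d1[OF that, of \<omega>] bounds M_pos
          by (intro mult_left_mono) (auto simp: M_def)
        finally show ?thesis using M_pos by (simp add: algebra_simps)
      qed
      then have "d1 n y \<le> M - \<epsilon>'"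
        using d1_le_iff[OF assms(1)] by blast
      moreover have "d \<le> d1 n y"
        unfolding d_def using d1_sets_le[OF assms(1) y] .
      moreover have "0 < d1 n y"
        using d1_pos_of_Inter_empty[OF assms(1,2) y] .
      \<comment> \<open>If \<open>d > 0\<close>, then \<open>M - \<epsilon>' < d\<close> clashes
        with \<open>d \<le> d1 n y\<close>. If \<open>d = 0\<close>, the upper bound
        \<open>M - \<epsilon>'\<close> is \<open>0\<close>, against the positivity of
        \<open>d1 n y\<close>.\<close>
      ultimately show False using \<epsilon>' by auto
    qed
  qed
  show ?thesis
    unfolding Let_def M_def[symmetric] d_def[symmetric]
    using M_pos main by blast
qed

end
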